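(* Let $V$ be a finite set of agents, $A=\{a,b\}$ with $a\ne b$, and $\mathcal P=\times_{v\in V}\mathcal W_v$ with $\emptyset\neq\mathcal W_v\subseteq\mathcal W(A)$ for every $v\in V$. Let $\chi_{bi}:\mathcal P\to\mathcal V$ be the function $\chi_{bi}(P)=\big(D(a,P),\,D(a,P)\cup I(P)\big)$. Then there is a bijection $\Sigma\mapsto\phi_\Sigma$ from the set of all antichains $\Sigma$ of the poset $\big(\chi_{bi}(\mathcal P),\le_{\mathcal V}\big)$ onto the set of all weakly group strategy-proof social choice functions from $\mathcal P$ to $\{a,b\}$, where, for an antichain $\Sigma$, the function $\phi_\Sigma$ is defined by $$\phi_\Sigma(P)=\begin{cases}a,&\text{if there is }(S,T)\in\Sigma\text{ with }\big(D(a,P),\,D(a,P)\cup I(P)\big)\ge_{\mathcal V}(S,T),\\ b,&\text{otherwise.}\end{cases}$$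
   Context: $\mathcal W(A)$ is the set of all complete, transitive binary relations (preferences) on $A$. For $W\in\mathcal W(A)$: $x\succ_W y$ means $(x,y)\in W$ and $(y,x)\notin W$; $x\sim_W y$ means both $(x,y),(y,x)\in W$. The elements of $\mathcal P$ are the feasible profiles $P=(P_v)_{v\in V}$. A social choice function $\phi:\mathcal P\to A$ is weakly group strategy-proof if there are no nonempty $D\subseteq V$ and $P,Q\in\mathcal P$ such that $P_v=Q_v$ for all $v\in V\setminus D$ and $\phi(Q)\succ_{P_v}\phi(P)$ for all $v\in D$. $D(a,P)=\{v\in V: a\succ_{P_v} b\}$ and $I(P)=\{v\in V: a\sim_{P_v} b\}$. $\mathcal V=\{(S,W)\in 2^V\times 2^V: S\subseteq W\}$, partially ordered by componentwise inclusion: $(S,W)\le_{\mathcal V}(S',W')$ iff $S\subseteq S'$ and $W\subseteq W'$. $\chi_{bi}(\mathcal P)$ is the image of $\chi_{bi}$, with the restricted order. An antichain of a poset is a subset in which no two distinct elements are comparable (the empty set is an antichain). *)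

theory Defs
  imports Main "HOL-Library.FuncSet" "HOL-Library.Product_Order"
begin

text \<open>Completeness includes the case \<open>x = y\<close>, so preferences are reflexive on \<open>A\<close>
  (unlike what \<^const>\<open>total_on\<close> alone would give).\<close>

definition preferences :: "'x set \<Rightarrow> 'x rel set" where
  "preferences A =
     {W. W \<subseteq> A \<times> A \<and> (\<forall>x\<in>A. \<forall>y\<in>A. (x, y) \<in> W \<or> (y, x) \<in> W) \<and> trans W}"

definition strictly_prefers :: "'x rel \<Rightarrow> 'x \<Rightarrow> 'x \<Rightarrow> bool" where
  "strictly_prefers W x y \<longleftrightarrow> (x, y) \<in> W \<and> (y, x) \<notin> W"

definition indifferent :: "'x rel \<Rightarrow> 'x \<Rightarrow> 'x \<Rightarrow> bool" where
  "indifferent W x y \<longleftrightarrow> (x, y) \<in> W \<and> (y, x) \<in> W"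

text \<open>Profiles and social choice functions are extensional functions
  (\<^const>\<open>PiE\<close>), so that HOL equality is equality on the set-theoretic domain.\<close>

definition profiles :: "'v set \<Rightarrow> ('v \<Rightarrow> 'x rel set) \<Rightarrow> ('v \<Rightarrow> 'x rel) set" where
  "profiles V \<W> = (\<Pi>\<^sub>E v\<in>V. \<W> v)"

definition social_choice_functions ::
  "('v \<Rightarrow> 'x rel) set \<Rightarrow> 'x set \<Rightarrow> (('v \<Rightarrow> 'x rel) \<Rightarrow> 'x) set" where
  "social_choice_functions \<P> A = (\<P> \<rightarrow>\<^sub>E A)"

definition weakly_group_strategy_proof ::
  "'v set \<Rightarrow> ('v \<Rightarrow> 'x rel) set \<Rightarrow> (('v \<Rightarrow> 'x rel) \<Rightarrow> 'x) \<Rightarrow> bool" where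
  "weakly_group_strategy_proof V \<P> \<phi> \<longleftrightarrow>
     \<not> (\<exists>D P Q. D \<noteq> {} \<and> D \<subseteq> V \<and> P \<in> \<P> \<and> Q \<in> \<P> \<and>
          (\<forall>v\<in>V - D. P v = Q v) \<and>
          (\<forall>v\<in>D. strictly_prefers (P v) (\<phi> Q) (\<phi> P)))"

definition supporters :: "'v set \<Rightarrow> 'x \<Rightarrow> 'x \<Rightarrow> ('v \<Rightarrow> 'x rel) \<Rightarrow> 'v set" where
  "supporters V a b P = {v\<in>V. strictly_prefers (P v) a b}"

definition indifferents :: "'v set \<Rightarrow> 'x \<Rightarrow> 'x \<Rightarrow> ('v \<Rightarrow> 'x rel) \<Rightarrow> 'v set" where
  "indifferents V a b P = {v\<in>V. indifferent (P v) a b}"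

text \<open>On pairs of sets, the order of \<^theory>\<open>HOL-Library.Product_Order\<close> is
  componentwise inclusion; it serves as the order on \<open>nested_pairs V\<close> and on its subsets.\<close>

definition nested_pairs :: "'v set \<Rightarrow> ('v set \<times> 'v set) set" where
  "nested_pairs V = {(S, W). S \<subseteq> W \<and> W \<subseteq> V}"

definition chi_bi :: "'v set \<Rightarrow> 'x \<Rightarrow> 'x \<Rightarrow> ('v \<Rightarrow> 'x rel) \<Rightarrow> 'v set \<times> 'v set" where
  "chi_bi V a b P = (supporters V a b P, supporters V a b P \<union> indifferents V a b P)"

lemma chi_bi_in_nested_pairs: "chi_bi V a b P \<in> nested_pairs V"
  by (auto simp: chi_bi_def nested_pairs_def supporters_def indifferents_def)

definition antichains :: "'p::order set \<Rightarrow> 'p set set" where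
  "antichains X = {\<Sigma>. \<Sigma> \<subseteq> X \<and> (\<forall>x\<in>\<Sigma>. \<forall>y\<in>\<Sigma>. x \<noteq> y \<longrightarrow> \<not> x \<le> y \<and> \<not> y \<le> x)}"

definition phi ::
  "'v set \<Rightarrow> ('v \<Rightarrow> 'x rel) set \<Rightarrow> 'x \<Rightarrow> 'x \<Rightarrow> ('v set \<times> 'v set) set \<Rightarrow> ('v \<Rightarrow> 'x rel) \<Rightarrow> 'x" where
  "phi V \<P> a b \<Sigma> =
     (\<lambda>P\<in>\<P>. if \<exists>(S, T)\<in>\<Sigma>. (S, T) \<le> chi_bi V a b P then a else b)"

end

theory Submission
  imports Defs
begin

text \<open>Weak group strategy-proofness says exactly that \<open>\<phi> P = a\<close> is preserved when
  \<open>chi_bi P\<close> grows, so such \<open>\<phi>\<close> correspond to the up-sets of the image of \<open>chi_bi\<close>, and an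
  up-set of a finite poset corresponds to the antichain of its minimal elements.\<close>

text \<open>Descending from \<open>x\<close> in \<open>\<Sigma>\<close> to \<open>y\<close> in
  \<open>\<Sigma>'\<close> and on to \<open>z\<close> in \<open>\<Sigma>\<close>, the antichain
  property collapses \<open>z \<le> y \<le> x\<close> to equalities. The roles are symmetric, so two
  applications give the injectivity of \<open>phi\<close>.\<close>

lemma antichain_subset_if_same_up_closure:
  fixes \<Sigma> \<Sigma>' :: "'p::order set"
  assumes "\<Sigma> \<in> antichains X" "\<Sigma>' \<in> antichains X"
    and same: "\<And>x. x \<in> X \<Longrightarrow> (\<exists>s\<in>\<Sigma>. s \<le> x) \<longleftrightarrow> (\<exists>s\<in>\<Sigma>'. s \<le> x)"
  shows "\<Sigma> \<subseteq> \<Sigma>'"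
proof
  fix x assume x: "x \<in> \<Sigma>"
  have X: "\<Sigma> \<subseteq> X" "\<Sigma>' \<subseteq> X" using assms by (auto simp: antichains_def)
  obtain y where y: "y \<in> \<Sigma>'" "y \<le> x" using same x X by blast
  obtain z where z: "z \<in> \<Sigma>" "z \<le> y" using same y X by blast
  have "z = x" using x z y assms(1) by (force simp: antichains_def)
  then show "x \<in> \<Sigma>'" using y z by simp
qed

text \<open>The minimal elements of \<open>U\<close> form the antichain. Finiteness puts a minimal
  element below every member of \<open>U\<close>, and upward closure gives the converse. This serves
  surjectivity.\<close>

lemma obtain_generating_antichain:
  fixes X U :: "'p::order set"
  assumes "finite X" "U \<subseteq> X" and up: "\<And>x y. x \<in> U \<Longrightarrow> y \<in> X \<Longrightarrow> x \<le> y \<Longrightarrow> y \<in> U"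
  obtains \<Sigma> where "\<Sigma> \<in> antichains X" "\<And>x. x \<in> X \<Longrightarrow> (\<exists>s\<in>\<Sigma>. s \<le> x) \<longleftrightarrow> x \<in> U"
proof
  let ?S = "{m \<in> U. \<forall>u\<in>U. u \<le> m \<longrightarrow> m = u}"
  show "?S \<in> antichains X" using \<open>U \<subseteq> X\<close> by (auto simp: antichains_def)
  have "finite U" using \<open>finite X\<close> \<open>U \<subseteq> X\<close> by (rule rev_finite_subset)
  show "(\<exists>s\<in>?S. s \<le> x) \<longleftrightarrow> x \<in> U" if "x \<in> X" for x
  proof
    assume "\<exists>s\<in>?S. s \<le> x"
    then show "x \<in> U" using up that by blast
  next
    assume "x \<in> U"
    then show "\<exists>s\<in>?S. s \<le> x" using finite_has_minimal2[OF \<open>finite U\<close>] by blast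
  qed
qed

lemma strictly_prefers_cases:
  assumes "W \<in> preferences {a, b}"
  shows "strictly_prefers W b a \<longleftrightarrow> \<not> strictly_prefers W a b \<and> \<not> indifferent W a b"
  using assms by (auto simp: preferences_def strictly_prefers_def indifferent_def)

text \<open>Completeness forces the diagonal pairs, so only \<open>(a, b)\<close> and
  \<open>(b, a)\<close> are free, and the two tests recover both of them.\<close>

lemma preferences_eqI:
  assumes "W \<in> preferences {a, b}" "W' \<in> preferences {a, b}"
    and "strictly_prefers W a b \<longleftrightarrow> strictly_prefers W' a b"
    and "indifferent W a b \<longleftrightarrow> indifferent W' a b"
  shows "W = W'"
proof -
  have eq: "(x, y) \<in> W \<longleftrightarrow> (x, y) \<in> W'" if "x \<in> {a, b}" "y \<in> {a, b}" for x y
    using assms that unfolding preferences_def strictly_prefers_def indifferent_def by blast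
  have "W \<subseteq> {a, b} \<times> {a, b}" "W' \<subseteq> {a, b} \<times> {a, b}"
    using assms by (auto simp: preferences_def)
  with eq show ?thesis by auto
qed

text \<open>Rank the positions of a voter as \<open>b\<close> over \<open>a\<close>, then
  indifference, then \<open>a\<close> over \<open>b\<close>: for preferences on
  \<open>{a, b}\<close> the order says that no voter steps down from \<open>P\<close> to
  \<open>Q\<close>.\<close>

lemma chi_bi_le_iff:
  "chi_bi V a b P \<le> chi_bi V a b Q \<longleftrightarrow>
     (\<forall>v\<in>V. (strictly_prefers (P v) a b \<longrightarrow> strictly_prefers (Q v) a b) \<and>
            (indifferent (P v) a b \<longrightarrow> strictly_prefers (Q v) a b \<or> indifferent (Q v) a b))"
  by (auto simp: chi_bi_def supporters_def indifferents_def)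

text \<open>Members of a gaining coalition all rank the two alternatives the same strict way, so
  their deviation moves \<open>chi_bi\<close> in one direction only, against which monotonicity
  protects. Conversely, a failure of monotonicity splits at an intermediate profile into two steps,
  and the one where the outcome changes is a manipulation, read forwards or backwards.\<close>

lemma weakly_group_strategy_proof_iff_mono:
  fixes \<W> :: "'v \<Rightarrow> 'x rel set"
  assumes ab: "a \<noteq> b"
    and pref: "\<And>v. v \<in> V \<Longrightarrow> \<W> v \<subseteq> preferences {a, b}"
    and \<phi>: "\<phi> \<in> social_choice_functions (profiles V \<W>) {a, b}"
  shows "weakly_group_strategy_proof V (profiles V \<W>) \<phi> \<longleftrightarrow>
    (\<forall>P\<in>profiles V \<W>. \<forall>Q\<in>profiles V \<W>.
       \<phi> P = a \<longrightarrow> chi_bi V a b P \<le> chi_bi V a b Q \<longrightarrow> \<phi> Q = a)"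
    (is "?wgsp \<longleftrightarrow> ?mono")
proof
  have vals: "\<phi> P = a \<or> \<phi> P = b" if "P \<in> profiles V \<W>" for P
    using \<phi> that by (auto simp: social_choice_functions_def)
  have prefs: "P v \<in> preferences {a, b}" if "P \<in> profiles V \<W>" "v \<in> V" for P v
    using pref that by (auto simp: profiles_def)
  show ?mono if ?wgsp
  proof (intro ballI impI, rule ccontr)
    fix P Q
    assume P: "P \<in> profiles V \<W>" and Q: "Q \<in> profiles V \<W>" and Pa: "\<phi> P = a"
      and le: "chi_bi V a b P \<le> chi_bi V a b Q" and "\<phi> Q \<noteq> a"
    then have Qb: "\<phi> Q = b" using vals by blast
    \<comment> \<open>Only the voters preferring \<open>b\<close> move first: they would be glad to obtain \<open>b\<close> at \<open>P\<close>,
      while the voters moving second all prefer \<open>a\<close> at \<open>Q\<close>.\<close>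
    define R where "R = (\<lambda>v. if strictly_prefers (P v) b a then Q v else P v)"
    have R: "R \<in> profiles V \<W>"
      using P Q by (auto simp: R_def profiles_def PiE_iff extensional_def)
    \<comment> \<open>The coalition is taken to be exactly the voters whose preferences differ. It
      is nonempty because profiles are extensional, so distinct ones differ at some voter in
      \<open>V\<close>.\<close>
    have no_manipulation: False
      if "P \<in> profiles V \<W>" "Q \<in> profiles V \<W>" "\<phi> Q \<noteq> \<phi> P"
        "\<And>v. v \<in> V \<Longrightarrow> P v \<noteq> Q v \<Longrightarrow> strictly_prefers (P v) (\<phi> Q) (\<phi> P)" for P Q
    proof -
      let ?D = "{v \<in> V. P v \<noteq> Q v}"
      have "P \<noteq> Q" using that(3) by auto
      then have "?D \<noteq> {}"
        using that(1,2) PiE_ext[of P V \<W> Q] by (auto simp: profiles_def)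
      moreover have "?D \<subseteq> V" "\<forall>v\<in>V - ?D. P v = Q v" by auto
      moreover have "\<forall>v\<in>?D. strictly_prefers (P v) (\<phi> Q) (\<phi> P)" using that(4) by simp
      ultimately have "\<not> ?wgsp"
        unfolding weakly_group_strategy_proof_def not_not
        using that(1,2) by (intro exI[of _ ?D] exI[of _ P] exI[of _ Q] conjI)
      then show False using \<open>?wgsp\<close> by contradiction
    qed
    show False
    proof (cases "\<phi> R = a")
      case True
      \<comment> \<open>Here \<open>Q\<close> is the true profile and \<open>R\<close> the
        misreport. A voter with \<open>Q v \<noteq> R v\<close> has \<open>R v = P v\<close> and
        does not prefer \<open>b\<close> at \<open>P\<close>. Preferring \<open>a\<close> there
        would force \<open>P v = Q v\<close>, so the voter is indifferent at \<open>P\<close> and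
        can only have moved up to \<open>a\<close>.\<close>
      have "strictly_prefers (Q v) a b" if v: "v \<in> V" "Q v \<noteq> R v" for v
      proof -
        have "\<not> strictly_prefers (P v) b a" "P v \<noteq> Q v"
          using v(2) by (metis R_def)+
        moreover have "\<not> (strictly_prefers W a b \<and> indifferent W a b)" for W
          by (simp add: strictly_prefers_def indifferent_def)
        ultimately show ?thesis
          using le[unfolded chi_bi_le_iff, rule_format, OF v(1)]
            strictly_prefers_cases[OF prefs[OF P v(1)]]
            preferences_eqI[OF prefs[OF P v(1)] prefs[OF Q v(1)]]
          by blast
      qed
      then show False using no_manipulation[OF Q R] True Qb ab by simp
    next
      case False
      then have "\<phi> R = b" using vals R by blast
      moreover have "strictly_prefers (P v) b a" if "P v \<noteq> R v" for v
        using that by (metis R_def)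
      ultimately show False using no_manipulation[OF P R] Pa ab by simp
    qed
  qed
  show ?wgsp if ?mono
    unfolding weakly_group_strategy_proof_def
  proof (rule notI, elim exE conjE)
    fix D P Q
    assume D: "D \<noteq> {}" "D \<subseteq> V" and P: "P \<in> profiles V \<W>" and Q: "Q \<in> profiles V \<W>"
      and eq: "\<forall>v\<in>V - D. P v = Q v"
      and gain: "\<forall>v\<in>D. strictly_prefers (P v) (\<phi> Q) (\<phi> P)"
    have "\<phi> P \<noteq> \<phi> Q" using D gain by (auto simp: strictly_prefers_def)
    then consider "\<phi> P = a" "\<phi> Q = b" | "\<phi> P = b" "\<phi> Q = a"
      using vals P Q by metis
    then show False
    proof cases
      case 1
      \<comment> \<open>The coalition prefers \<open>b\<close> at \<open>P\<close>, hence lies in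
        neither component of \<open>chi_bi V a b P\<close>; any reports at \<open>Q\<close> can only
        enlarge the components.\<close>
      then have "\<forall>v\<in>V. P v = Q v \<or> strictly_prefers (P v) b a" using eq gain by auto
      then have "chi_bi V a b P \<le> chi_bi V a b Q"
        unfolding chi_bi_le_iff strictly_prefers_def indifferent_def by fastforce
      then have "\<phi> Q = a" using \<open>?mono\<close> P Q 1(1) by blast
      then show False using 1 ab by simp
    next
      case 2
      \<comment> \<open>Dually, the coalition already lies in both components at \<open>P\<close>,
        so its deviation can only shrink them.\<close>
      then have "\<forall>v\<in>V. P v = Q v \<or> strictly_prefers (P v) a b" using eq gain by auto
      then have "chi_bi V a b Q \<le> chi_bi V a b P"
        unfolding chi_bi_le_iff by fastforce
      then have "\<phi> P = a" using \<open>?mono\<close> P Q 2(2) by blast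
      then show False using 2 ab by simp
    qed
  qed
qed

lemma phi_eq_iff:
  assumes "a \<noteq> b" "P \<in> \<P>"
  shows "phi V \<P> a b \<Sigma> P = a \<longleftrightarrow> (\<exists>s\<in>\<Sigma>. s \<le> chi_bi V a b P)"
  using assms by (auto simp: phi_def)

lemma phi_in_social_choice_functions:
  "phi V \<P> a b \<Sigma> \<in> social_choice_functions \<P> {a, b}"
  by (auto simp: phi_def social_choice_functions_def)

theorem corollary5p3:
  fixes V :: "'v set" and a b :: 'x and \<W> :: "'v \<Rightarrow> 'x rel set"
  assumes "finite V"
    and "a \<noteq> b"
    and "\<And>v. v \<in> V \<Longrightarrow> \<W> v \<noteq> {}"
    and "\<And>v. v \<in> V \<Longrightarrow> \<W> v \<subseteq> preferences {a, b}"
  shows "bij_betw (phi V (profiles V \<W>) a b)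
           (antichains (chi_bi V a b ` profiles V \<W>))
           {\<phi> \<in> social_choice_functions (profiles V \<W>) {a, b}.
              weakly_group_strategy_proof V (profiles V \<W>) \<phi>}"
proof -
  let ?\<P> = "profiles V \<W>"
  let ?\<chi> = "chi_bi V a b"
  let ?X = "?\<chi> ` ?\<P>"
  let ?\<phi> = "phi V ?\<P> a b"
  have wgsp_iff: "weakly_group_strategy_proof V ?\<P> \<phi> \<longleftrightarrow>
      (\<forall>P\<in>?\<P>. \<forall>Q\<in>?\<P>. \<phi> P = a \<longrightarrow> ?\<chi> P \<le> ?\<chi> Q \<longrightarrow> \<phi> Q = a)"
    if "\<phi> \<in> social_choice_functions ?\<P> {a, b}" for \<phi>
    using assms(2,4) that by (rule weakly_group_strategy_proof_iff_mono)
  have phi_iff: "?\<phi> \<Sigma> P = a \<longleftrightarrow> (\<exists>s\<in>\<Sigma>. s \<le> ?\<chi> P)" if "P \<in> ?\<P>" for \<Sigma> P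
    using phi_eq_iff[OF \<open>a \<noteq> b\<close> that] .
  have "?X \<subseteq> Pow V \<times> Pow V"
    by (auto simp: chi_bi_def supporters_def indifferents_def)
  then have "finite ?X"
    using \<open>finite V\<close> by (meson finite_Pow_iff finite_SigmaI finite_subset)
  show ?thesis
    unfolding bij_betw_def
  proof (intro conjI subset_antisym)
    show "inj_on ?\<phi> (antichains ?X)"
    proof (rule inj_onI)
      fix \<Sigma> \<Sigma>'
      assume "\<Sigma> \<in> antichains ?X" "\<Sigma>' \<in> antichains ?X" and eq: "?\<phi> \<Sigma> = ?\<phi> \<Sigma>'"
      moreover have "(\<exists>s\<in>\<Sigma>. s \<le> x) \<longleftrightarrow> (\<exists>s\<in>\<Sigma>'. s \<le> x)" if "x \<in> ?X" for x
      proof -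
        obtain P where "P \<in> ?\<P>" "x = ?\<chi> P" using \<open>x \<in> ?X\<close> by blast
        then show ?thesis using phi_iff[of P \<Sigma>] phi_iff[of P \<Sigma>'] eq by simp
      qed
      ultimately show "\<Sigma> = \<Sigma>'"
        by (intro subset_antisym antichain_subset_if_same_up_closure[where X = ?X]) auto
    qed
    \<comment> \<open>Any \<open>\<Sigma>\<close> will do here: the elements above some member of it
      form an up-set by transitivity.\<close>
    have "weakly_group_strategy_proof V ?\<P> (?\<phi> \<Sigma>)" for \<Sigma>
    proof (intro iffD2[OF wgsp_iff[OF phi_in_social_choice_functions]] ballI impI)
      fix P Q
      assume P: "P \<in> ?\<P>" and Q: "Q \<in> ?\<P>" and "?\<phi> \<Sigma> P = a" and le: "?\<chi> P \<le> ?\<chi> Q"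
      then obtain s where "s \<in> \<Sigma>" "s \<le> ?\<chi> P" using phi_iff[OF P] by blast
      then show "?\<phi> \<Sigma> Q = a" using phi_iff[OF Q] order_trans[OF _ le] by blast
    qed
    then show "?\<phi> ` antichains ?X \<subseteq>
        {\<phi> \<in> social_choice_functions ?\<P> {a, b}. weakly_group_strategy_proof V ?\<P> \<phi>}"
      by (simp add: image_subset_iff phi_in_social_choice_functions)
    show "{\<phi> \<in> social_choice_functions ?\<P> {a, b}. weakly_group_strategy_proof V ?\<P> \<phi>}
        \<subseteq> ?\<phi> ` antichains ?X"
    proof (rule subsetI, elim CollectE conjE)
      fix \<phi>
      assume scf: "\<phi> \<in> social_choice_functions ?\<P> {a, b}"
        and "weakly_group_strategy_proof V ?\<P> \<phi>"
      then have mono: "\<phi> Q = a"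
        if "P \<in> ?\<P>" "Q \<in> ?\<P>" "\<phi> P = a" "?\<chi> P \<le> ?\<chi> Q" for P Q
        using wgsp_iff that by blast
      \<comment> \<open>Monotonicity makes this image an up-set of \<open>?X\<close>; its minimal
        elements are the required preimage of \<open>\<phi>\<close>.\<close>
      define U where "U = ?\<chi> ` {P \<in> ?\<P>. \<phi> P = a}"
      have "U \<subseteq> ?X" by (auto simp: U_def)
      moreover have "y \<in> U" if "x \<in> U" "y \<in> ?X" "x \<le> y" for x y
        using that mono unfolding U_def by blast
      ultimately obtain \<Sigma> where \<Sigma>: "\<Sigma> \<in> antichains ?X"
        and up: "\<And>x. x \<in> ?X \<Longrightarrow> (\<exists>s\<in>\<Sigma>. s \<le> x) \<longleftrightarrow> x \<in> U"
        using obtain_generating_antichain[OF \<open>finite ?X\<close>] by metis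
      have "\<phi> = ?\<phi> \<Sigma>"
      proof (rule PiE_ext)
        show "\<phi> \<in> ?\<P> \<rightarrow>\<^sub>E {a, b}" "?\<phi> \<Sigma> \<in> ?\<P> \<rightarrow>\<^sub>E {a, b}"
          using scf phi_in_social_choice_functions[of V ?\<P> a b \<Sigma>]
          by (simp_all add: social_choice_functions_def)
        fix P assume P: "P \<in> ?\<P>"
        have "?\<phi> \<Sigma> P = a \<longleftrightarrow> ?\<chi> P \<in> U" using phi_iff P up by blast
        also have "\<dots> \<longleftrightarrow> \<phi> P = a"
        proof
          assume "?\<chi> P \<in> U"
          \<comment> \<open>Membership in \<open>U\<close> only yields some profile with the same
            \<open>chi_bi\<close> value. Monotonicity, applied to equal values, makes
            \<open>\<phi>\<close> constant on the fibres of \<open>chi_bi\<close>.\<close>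
          then obtain P' where "P' \<in> ?\<P>" "\<phi> P' = a" "?\<chi> P = ?\<chi> P'"
            by (auto simp: U_def)
          then show "\<phi> P = a" using mono[OF _ P] by simp
        next
          assume "\<phi> P = a"
          then show "?\<chi> P \<in> U" using P by (auto simp: U_def)
        qed
        finally have "?\<phi> \<Sigma> P = a \<longleftrightarrow> \<phi> P = a" .
        \<comment> \<open>With only two possible values, agreement on when the value is
          \<open>a\<close> settles the equality.\<close>
        moreover have "\<phi> P \<in> {a, b}" "?\<phi> \<Sigma> P \<in> {a, b}"
          using P scf phi_in_social_choice_functions[of V ?\<P> a b \<Sigma>]
          unfolding social_choice_functions_def by (blast intro: PiE_mem)+
        ultimately show "\<phi> P = ?\<phi> \<Sigma> P" by (elim insertE) simp_all
      qed
      then show "\<phi> \<in> ?\<phi> ` antichains ?X" using \<Sigma> by blast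
    qed
  qed
qed

end
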